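(* Let $s,t\ge 1$ be integers and let $q$ be a scalar with $q\neq -1$ and $(q+1)^2(s-1)(t-1)\neq st$. Let $\mathscr{D}(K_{s,t})$ be the $q$-distance matrix of $K_{s,t}$, with the $s$ vertices of one part listed first and the $t$ vertices of the other part listed last. Then $$\mathscr{D}(K_{s,t})^{-1}=\frac{1}{(q+1)\left[(q+1)^2(s-1)(t-1)-st\right]}\begin{bmatrix}((q+1)^2(t-1)-t)\mathbf{J}_s & -(q+1)\mathbf{J}_{s\times t}\\ -(q+1)\mathbf{J}_{t\times s} & ((q+1)^2(s-1)-s)\mathbf{J}_t\end{bmatrix}-\frac{1}{q+1}\mathbf{I}_{s+t}.$$
   Context: $q$ is a real or complex number (the paper calls it an indeterminate). For an integer $\alpha\ge 1$ put $[\alpha]=1+q+\cdots+q^{\alpha-1}$, and $[0]=0$. The $q$-distance matrix of a connected graph with vertices $v_1,\dots,v_N$ is the $N\times N$ matrix with $(i,j)$ entry $[d(v_i,v_j)]$, $d$ the shortest-path distance. $\mathbf{J}_{m\times n}$ is the all-ones $m\times n$ matrix, $\mathbf{J}_m=\mathbf{J}_{m\times m}$, and $\mathbf{I}_n$ is the identity matrix. *)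

theory Defs
  imports "Graph_Theory.Kuratowski" "Graph_Theory.Shortest_Path" "Jordan_Normal_Form.Matrix"
begin

definition q_number :: "'k::semiring_1 \<Rightarrow> nat \<Rightarrow> 'k" where
  "q_number q n = (\<Sum>i<n. q ^ i)"

text \<open>Undirected graphs are the symmetric digraphs of the locale \<open>graph\<close>. The distance is
  the number of edges of a shortest path; it is only meaningful if some path exists.\<close>

definition graph_dist :: "('a, 'b) pre_digraph \<Rightarrow> 'a \<Rightarrow> 'a \<Rightarrow> nat" where
  "graph_dist G u v = (LEAST n. \<exists>p. pre_digraph.apath G u p v \<and> length p = n)"

lemma (in wf_digraph) awalk_cost_unit: "awalk_cost (\<lambda>_. 1) p = real (length p)"
  by (induction p) auto

lemma (in wf_digraph) graph_dist_eq_mu: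
  assumes "u \<rightarrow>\<^sup>*\<^bsub>G\<^esub> v"
  shows "\<mu> (\<lambda>_. 1) u v = ereal (real (graph_dist G u v))"
proof -
  obtain p where "apath u p v"
    using assms reachable_apath by blast
  then obtain r where r: "apath u r v" "length r = graph_dist G u v"
    unfolding graph_dist_def
    using LeastI_ex[of "\<lambda>n. \<exists>p. apath u p v \<and> length p = n"] by auto
  have le: "graph_dist G u v \<le> length p'" if "awalk u p' v" for p'
  proof -
    have "apath u (awalk_to_apath p') v"
      using that by (rule apath_awalk_to_apath)
    then have "graph_dist G u v \<le> length (awalk_to_apath p')"
      unfolding graph_dist_def by (blast intro: Least_le)
    also have "\<dots> \<le> length p'"
      using that
    proof (induction rule: awalk_to_apath_induct)
      case (path p)
      then show ?case by (subst awalk_to_apath.simps) auto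
    next
      case (decomp p a b c)
      then have "p = a @ b @ c"
        using awalk_cyc_decomp_has_prop[of u p v] by simp
      then show ?case
        using decomp step_awalk_to_apath by auto
    qed
    finally show ?thesis .
  qed
  show ?thesis
    unfolding \<mu>_def
  proof (rule antisym)
    show "(INF p\<in>{p. awalk u p v}. ereal (awalk_cost (\<lambda>_. 1) p)) \<le> ereal (real (graph_dist G u v))"
      using r by (intro INF_lower2[of r]) (auto simp: awalk_cost_unit apath_def)
    show "ereal (real (graph_dist G u v)) \<le> (INF p\<in>{p. awalk u p v}. ereal (awalk_cost (\<lambda>_. 1) p))"
      using le by (intro INF_greatest) (auto simp: awalk_cost_unit)
  qed
qed

text \<open>The list \<open>vs\<close> enumerates the vertices and fixes the order of rows and columns.\<close>

definition q_distance_matrix ::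
    "'k::semiring_1 \<Rightarrow> ('a, 'b) pre_digraph \<Rightarrow> 'a list \<Rightarrow> 'k mat" where
  "q_distance_matrix q G vs =
     mat (length vs) (length vs) (\<lambda>(i, j). q_number q (graph_dist G (vs ! i) (vs ! j)))"

definition complete_bipartite_on :: "('a, 'b) pre_digraph \<Rightarrow> 'a set \<Rightarrow> 'a set \<Rightarrow> bool" where
  "complete_bipartite_on G U V \<longleftrightarrow>
     graph G \<and> verts G = U \<union> V \<and> U \<inter> V = {} \<and> arcs_ends G = U \<times> V \<union> V \<times> U"

lemma complete_bipartite_digraph_iff:
  "K\<^bsub>m,n\<^esub> G \<longleftrightarrow> (\<exists>U V. complete_bipartite_on G U V \<and> card U = m \<and> card V = n)"
  unfolding complete_bipartite_digraph_def complete_bipartite_on_def by blast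

definition ones_mat :: "nat \<Rightarrow> nat \<Rightarrow> 'k::one mat" where
  "ones_mat m n = mat m n (\<lambda>_. 1)"

end

theory Submission
  imports Defs "Jordan_Normal_Form.Determinant"
begin

text \<open>Write p = q + 1 and d = p^2 (s - 1)(t - 1) - s t. Distances in a complete bipartite
  graph are 0, 1 or 2 (\<open>graph_dist_complete_bipartite\<close>), and [2] = p, so D has diagonal
  blocks p (J - I) and off-diagonal blocks J (\<open>q_distance_matrix_complete_bipartite\<close>).
  Products of all-ones blocks are again multiples of all-ones blocks, and J - I acts on them as a
  scalar (\<open>ones_minus_one_mult_ones_mat\<close>). Hence D B, for the block matrix B of the
  claim, is found from scalars alone, and D B = d (D + p I). Dividing by p d and subtracting D / p
  leaves the identity.\<close>

lemma q_number_0 [simp]: "q_number q 0 = 0"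
  and q_number_1 [simp]: "q_number q (Suc 0) = 1"
  and q_number_2 [simp]: "q_number q 2 = 1 + q"
  by (simp_all add: q_number_def numeral_2_eq_2)

context wf_digraph
begin

lemma graph_dist_self:
  assumes "u \<in> verts G"
  shows "graph_dist G u u = 0"
  unfolding graph_dist_def
  using assms by (intro Least_equality) (auto intro!: exI[of _ "[]"] simp: apath_Nil_iff)

lemma graph_dist_adjacent:
  assumes "u \<rightarrow>\<^bsub>G\<^esub> v" and "u \<noteq> v"
  shows "graph_dist G u v = 1"
  unfolding graph_dist_def
proof (rule Least_equality)
  from assms(1) obtain e where "e \<in> arcs G" "tail G e = u" "head G e = v"
    by (auto simp: arcs_ends_conv)
  then have "apath u [e] v"
    using assms(2) by (auto simp: apath_def awalk_def)
  then show "\<exists>p. apath u p v \<and> length p = 1"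
    by (intro exI[of _ "[e]"]) simp
next
  fix n assume "\<exists>p. apath u p v \<and> length p = n"
  then show "1 \<le> n"
    using assms(2) by (cases n) (auto simp: apath_Nil_iff)
qed

lemma graph_dist_common_neighbour:
  assumes "u \<rightarrow>\<^bsub>G\<^esub> w" and "w \<rightarrow>\<^bsub>G\<^esub> v" and "u \<noteq> v" and "\<not> u \<rightarrow>\<^bsub>G\<^esub> v"
  shows "graph_dist G u v = 2"
  unfolding graph_dist_def
proof (rule Least_equality)
  obtain e f where "e \<in> arcs G" "tail G e = u" "head G e = w"
    and "f \<in> arcs G" "tail G f = w" "head G f = v"
    using assms(1,2) by (auto simp: arcs_ends_conv)
  \<comment> \<open>If w coincided with u or v, one of the two given arcs would join u to v.\<close>
  moreover have "u \<noteq> w" "w \<noteq> v"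
    using assms by auto
  ultimately have "apath u [e, f] v"
    using assms(3) by (auto simp: apath_def awalk_def)
  then show "\<exists>p. apath u p v \<and> length p = 2"
    by (intro exI[of _ "[e, f]"]) simp
next
  fix n assume "\<exists>p. apath u p v \<and> length p = n"
  then obtain p where p: "awalk u p v" "length p = n"
    by (auto simp: apath_def)
  show "2 \<le> n"
  proof (rule ccontr)
    assume "\<not> 2 \<le> n"
    \<comment> \<open>The case rule of \<open>remdups_adj\<close> serves only to split lists by
      length: zero, one, or at least two.\<close>
    then consider "p = []" | e where "p = [e]"
      using p(2) by (cases p rule: remdups_adj.cases) auto
    then show False
      using p(1) assms(3,4) by cases (auto simp: awalk_def arcs_ends_conv)
  qed
qed

end

text \<open>As the sides are disjoint, \<open>u \<in> U \<longleftrightarrow> v \<in> V\<close> says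
  that u and v lie on opposite sides. Distinct vertices on one side are not adjacent but share every
  vertex of the other, nonempty, side as a neighbour.\<close>

lemma graph_dist_complete_bipartite:
  assumes "complete_bipartite_on G U V" and "U \<noteq> {}" and "V \<noteq> {}"
    and "u \<in> U \<union> V" and "v \<in> U \<union> V"
  shows "graph_dist G u v = (if u = v then 0 else if u \<in> U \<longleftrightarrow> v \<in> V then 1 else 2)"
proof -
  interpret graph G
    using assms(1) by (simp add: complete_bipartite_on_def)
  have disj: "U \<inter> V = {}" and verts: "verts G = U \<union> V"
    and adj: "x \<rightarrow>\<^bsub>G\<^esub> y \<longleftrightarrow> (x, y) \<in> U \<times> V \<union> V \<times> U" for x y
    using assms(1) by (auto simp: complete_bipartite_on_def)
  obtain a b where ab: "a \<in> U" "b \<in> V"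
    using assms(2,3) by blast
  consider "u = v" | "u \<noteq> v" "u \<in> U \<longleftrightarrow> v \<in> V" | "u \<noteq> v" "\<not> (u \<in> U \<longleftrightarrow> v \<in> V)"
    by blast
  then show ?thesis
  proof cases
    case 1
    then show ?thesis
      using assms(4) verts by (simp add: graph_dist_self)
  next
    case 2
    then have "u \<rightarrow>\<^bsub>G\<^esub> v"
      using assms(4,5) disj unfolding adj by auto
    then show ?thesis
      using 2 by (simp add: graph_dist_adjacent)
  next
    case 3
    \<comment> \<open>A vertex opposite to u, hence also opposite to v.\<close>
    define w where "w = (if u \<in> U then b else a)"
    have "u \<rightarrow>\<^bsub>G\<^esub> w" "w \<rightarrow>\<^bsub>G\<^esub> v" "\<not> u \<rightarrow>\<^bsub>G\<^esub> v"
      using 3 assms(4,5) disj ab unfolding adj w_def by auto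
    then show ?thesis
      using 3 by (auto simp: graph_dist_common_neighbour)
  qed
qed

lemma ones_mat_carrier [simp]: "ones_mat m n \<in> carrier_mat m n"
  and dim_row_ones_mat [simp]: "dim_row (ones_mat m n) = m"
  and dim_col_ones_mat [simp]: "dim_col (ones_mat m n) = n"
  and index_ones_mat [simp]: "i < m \<Longrightarrow> j < n \<Longrightarrow> ones_mat m n $$ (i, j) = 1"
  by (simp_all add: ones_mat_def)

lemma ones_mat_mult:
  "(ones_mat l m * ones_mat m n :: 'k::comm_semiring_1 mat) = of_nat m \<cdot>\<^sub>m ones_mat l n"
  by (rule eq_matI) (auto simp: scalar_prod_def)

text \<open>The columns of the all-ones matrix are eigenvectors of J - I with eigenvalue m - 1,
  since J multiplies them by m.\<close>

lemma ones_minus_one_mult_ones_mat: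
  "(ones_mat m m - 1\<^sub>m m) * ones_mat m n = ((of_nat m - 1) \<cdot>\<^sub>m ones_mat m n :: 'k::comm_ring_1 mat)"
proof -
  have "(ones_mat m m - 1\<^sub>m m) * ones_mat m n
      = ones_mat m m * ones_mat m n - 1\<^sub>m m * (ones_mat m n :: 'k mat)"
    by (rule minus_mult_distrib_mat) auto
  also have "\<dots> = of_nat m \<cdot>\<^sub>m ones_mat m n - ones_mat m n"
    by (simp add: ones_mat_mult left_mult_one_mat[OF ones_mat_carrier])
  also have "\<dots> = (of_nat m - 1) \<cdot>\<^sub>m ones_mat m n"
    by (rule eq_matI) (auto simp: algebra_simps)
  finally show ?thesis .
qed

lemma q_distance_matrix_complete_bipartite:
  fixes q :: "'k::comm_ring_1"
  assumes "complete_bipartite_on G (set us) (set vs)"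
    and "distinct us" and "distinct vs" and "us \<noteq> []" and "vs \<noteq> []"
  defines "s \<equiv> length us" and "t \<equiv> length vs"
  shows "q_distance_matrix q G (us @ vs) =
    four_block_mat ((q + 1) \<cdot>\<^sub>m (ones_mat s s - 1\<^sub>m s)) (ones_mat s t)
      (ones_mat t s) ((q + 1) \<cdot>\<^sub>m (ones_mat t t - 1\<^sub>m t))" (is "_ = ?R")
proof (rule eq_matI)
  fix i j assume "i < dim_row ?R" and "j < dim_col ?R"
  then have i: "i < s + t" and j: "j < s + t"
    by simp_all
  have disj: "set us \<inter> set vs = {}"
    using assms(1) by (simp add: complete_bipartite_on_def)
  then have "distinct (us @ vs)"
    using assms(2,3) by simp
  \<comment> \<open>From here on vertices are replaced by their positions: equality of vertices is
    equality of indices, and comparison with s decides the side.\<close>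
  then have eq: "(us @ vs) ! i = (us @ vs) ! j \<longleftrightarrow> i = j"
    using i j by (simp add: nth_eq_iff_index_eq s_def t_def del: distinct_append)
  have mem: "(us @ vs) ! k \<in> set us \<union> set vs"
    and us: "(us @ vs) ! k \<in> set us \<longleftrightarrow> k < s"
    and vs: "(us @ vs) ! k \<in> set vs \<longleftrightarrow> \<not> k < s" if "k < s + t" for k
    using that disj nth_mem[of k us] nth_mem[of "k - s" vs]
    by (auto simp: nth_append s_def t_def disjoint_iff)
  have "graph_dist G ((us @ vs) ! i) ((us @ vs) ! j)
      = (if i = j then 0 else if i < s \<longleftrightarrow> \<not> j < s then 1 else 2)"
    using graph_dist_complete_bipartite[OF assms(1) _ _ mem[OF i] mem[OF j]] assms(4,5)
    by (simp add: eq us[OF i] vs[OF j])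
  then show "q_distance_matrix q G (us @ vs) $$ (i, j) = ?R $$ (i, j)"
    using i j by (auto simp: q_distance_matrix_def s_def t_def algebra_simps)
qed (simp_all add: q_distance_matrix_def s_def t_def)

theorem theorem3p5:
  fixes q :: "'k::real_normed_field"
    and s t :: nat
    and G :: "('a, 'b) pre_digraph"
    and us vs :: "'a list"
  assumes "1 \<le> s" and "1 \<le> t"
    and "complete_bipartite_on G (set us) (set vs)"
    and "distinct us" and "length us = s"
    and "distinct vs" and "length vs = t"
    and "q \<noteq> -1"
    and "(q + 1)\<^sup>2 * (of_nat s - 1) * (of_nat t - 1) \<noteq> of_nat s * of_nat t"
  shows "let D = q_distance_matrix q G (us @ vs);
             M = (1 / ((q + 1) * ((q + 1)\<^sup>2 * (of_nat s - 1) * (of_nat t - 1) - of_nat s * of_nat t)))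
                   \<cdot>\<^sub>m four_block_mat
                        (((q + 1)\<^sup>2 * (of_nat t - 1) - of_nat t) \<cdot>\<^sub>m ones_mat s s)
                        (- (q + 1) \<cdot>\<^sub>m ones_mat s t)
                        (- (q + 1) \<cdot>\<^sub>m ones_mat t s)
                        (((q + 1)\<^sup>2 * (of_nat s - 1) - of_nat s) \<cdot>\<^sub>m ones_mat t t)
                 - (1 / (q + 1)) \<cdot>\<^sub>m 1\<^sub>m (s + t)
         in inverts_mat D M \<and> inverts_mat M D"
proof -
  define p :: 'k where "p = q + 1"
  define x y :: 'k where "x = of_nat s" and "y = of_nat t"
  define d where "d = p\<^sup>2 * (x - 1) * (y - 1) - x * y"
  define D where "D = q_distance_matrix q G (us @ vs)"
  define B where "B = four_block_mat ((p\<^sup>2 * (y - 1) - y) \<cdot>\<^sub>m ones_mat s s) (- p \<cdot>\<^sub>m ones_mat s t)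
    (- p \<cdot>\<^sub>m ones_mat t s) ((p\<^sup>2 * (x - 1) - x) \<cdot>\<^sub>m ones_mat t t)"
  define M where "M = (1 / (p * d)) \<cdot>\<^sub>m B - (1 / p) \<cdot>\<^sub>m 1\<^sub>m (s + t)"
  have p: "p \<noteq> 0"
    using assms(8) by (simp add: p_def add_eq_0_iff2)
  have d: "d \<noteq> 0"
    using assms(9) by (simp add: d_def p_def x_def y_def)
  have D_block: "D = four_block_mat (p \<cdot>\<^sub>m (ones_mat s s - 1\<^sub>m s)) (ones_mat s t)
      (ones_mat t s) (p \<cdot>\<^sub>m (ones_mat t t - 1\<^sub>m t))"
    using q_distance_matrix_complete_bipartite[OF assms(3,4,6), of q] assms(1,2,5,7)
    by (fastforce simp: D_def p_def)
  have D_carrier: "D \<in> carrier_mat (s + t) (s + t)"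
    unfolding D_block by (intro four_block_carrier_mat) auto
  have B_carrier: "B \<in> carrier_mat (s + t) (s + t)"
    unfolding B_def by (intro four_block_carrier_mat) auto
  have M_carrier: "M \<in> carrier_mat (s + t) (s + t)"
    unfolding M_def by (intro minus_carrier_mat smult_carrier_mat one_carrier_mat)
  \<comment> \<open>The right-hand side is d (D + p I): adding p I turns the diagonal blocks p (J -
    I) of D into p J.\<close>
  have DB: "D * B = four_block_mat ((p * d) \<cdot>\<^sub>m ones_mat s s) (d \<cdot>\<^sub>m ones_mat s t)
      (d \<cdot>\<^sub>m ones_mat t s) ((p * d) \<cdot>\<^sub>m ones_mat t t)"
  proof -
    have smult_smult: "a \<cdot>\<^sub>m (b \<cdot>\<^sub>m A) = (a * b) \<cdot>\<^sub>m A" for a b :: 'k and A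
      by (rule eq_matI) (auto simp: mult.assoc)
    have ones_sum: "a \<cdot>\<^sub>m ones_mat m n + b \<cdot>\<^sub>m ones_mat m n = (a + b) \<cdot>\<^sub>m ones_mat m n"
      for a b :: 'k and m n
      by (rule add_smult_distrib_right_mat[OF ones_mat_carrier, symmetric])
    have diag: "(a \<cdot>\<^sub>m (ones_mat m m - 1\<^sub>m m)) * (b \<cdot>\<^sub>m ones_mat m n)
        = (a * b * (of_nat m - 1)) \<cdot>\<^sub>m ones_mat m n" for a b :: 'k and m n
    proof -
      have carrier: "ones_mat m m - 1\<^sub>m m \<in> carrier_mat m m"
        by (rule minus_carrier_mat) simp
      then show ?thesis
        by (simp add: mult_smult_assoc_mat[OF carrier smult_carrier_mat[OF ones_mat_carrier]]
            mult_smult_distrib[OF carrier ones_mat_carrier]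
            ones_minus_one_mult_ones_mat smult_smult mult.assoc)
    qed
    have off: "ones_mat l m * (b \<cdot>\<^sub>m ones_mat m n) = (b * of_nat m) \<cdot>\<^sub>m ones_mat l n"
      for b :: 'k and l m n
      by (simp add: mult_smult_distrib[OF ones_mat_carrier ones_mat_carrier] ones_mat_mult smult_smult)
    show ?thesis
      unfolding D_block B_def
      \<comment> \<open>Two scalar identities remain, up to exchanging x and y: p (p^2 (y - 1) -
        y)(x - 1) - p y = p d on the diagonal, and -p^2 (x - 1) + (p^2 (x - 1) - x) y = d off
        it.\<close>
      by (subst mult_four_block_mat[of _ s s _ t _ t _ _ s _ t])
        (simp_all add: minus_carrier_mat diag off ones_sum d_def flip: x_def y_def,
          simp_all add: algebra_simps power2_eq_square)
  qed
  have "D * M = (1 / (p * d)) \<cdot>\<^sub>m (D * B) - (1 / p) \<cdot>\<^sub>m D"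
  proof -
    have "D * M = D * ((1 / (p * d)) \<cdot>\<^sub>m B) - D * ((1 / p) \<cdot>\<^sub>m 1\<^sub>m (s + t))"
      unfolding M_def using D_carrier B_carrier by (intro mult_minus_distrib_mat) auto
    also have "\<dots> = (1 / (p * d)) \<cdot>\<^sub>m (D * B) - (1 / p) \<cdot>\<^sub>m D"
      using D_carrier B_carrier
      by (simp add: mult_smult_distrib[OF D_carrier B_carrier]
          mult_smult_distrib[OF D_carrier one_carrier_mat])
    finally show ?thesis .
  qed
  \<comment> \<open>By \<open>DB\<close> the first term is (1/p) D + I, so the multiples of D
    cancel.\<close>
  also have "\<dots> = 1\<^sub>m (s + t)"
    unfolding DB unfolding D_block using p d by (intro eq_matI) auto
  finally have DM: "D * M = 1\<^sub>m (s + t)" .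
  \<comment> \<open>Over a field a one-sided inverse of a square matrix is two-sided.\<close>
  then have "M * D = 1\<^sub>m (s + t)"
    by (rule mat_mult_left_right_inverse[OF D_carrier M_carrier])
  with DM have "inverts_mat D M \<and> inverts_mat M D"
    using D_carrier M_carrier by (simp add: inverts_mat_def)
  then show ?thesis
    unfolding Let_def D_def M_def B_def d_def p_def x_def y_def .
qed

end
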